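(* Suppose the following statement holds: for every set $L$ of lines in $\mathbb{F}_q^3$ with $|L|=\Omega(q^3)$ and such that no plane contains $\omega(q)$ lines of $L$, one has $|P(L)|\geq(1-o(1))q^3$. Then every Nikodym set $\mathcal{N}\subseteq\mathbb{F}_q^3$ satisfies $|\mathcal{N}|\geq(1-o(1))q^3$.
   Context: $\mathbb{F}_q$ is the finite field with $q$ elements; lines and planes are affine subspaces of $\mathbb{F}_q^3$ of dimension 1 and 2. For a set $L$ of lines, $P(L)=\bigcup_{\ell\in L}\ell$ is the set of points lying on some line of $L$. A Nikodym set $\mathcal{N}\subseteq\mathbb{F}_q^3$ is a set of points such that through every point $p\in\mathbb{F}_q^3$ there is a line $\ell$ with $\ell\setminus\{p\}\subseteq\mathcal{N}$. All asymptotic notation ($\Omega$, $\omega$, $o$) is with respect to $q\to\infty$. *)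

theory Defs
  imports "HOL-Algebra.Ring" "HOL-Algebra.Coset" "HOL-Library.Landau_Symbols"
begin

text \<open>
  The statement quantifies over finite fields of all sizes inside its hypothesis, so fields are
  records with explicit carriers rather than types of class \<open>field\<close>. Points of
  three-dimensional affine space over \<open>K\<close> are triples over the carrier.
\<close>

definition space3 :: "'a ring \<Rightarrow> ('a \<times> 'a \<times> 'a) set" where
  "space3 K = carrier K \<times> carrier K \<times> carrier K"

definition vzero :: "'a ring \<Rightarrow> 'a \<times> 'a \<times> 'a" where
  "vzero K = (\<zero>\<^bsub>K\<^esub>, \<zero>\<^bsub>K\<^esub>, \<zero>\<^bsub>K\<^esub>)"

fun vadd :: "'a ring \<Rightarrow> 'a \<times> 'a \<times> 'a \<Rightarrow> 'a \<times> 'a \<times> 'a \<Rightarrow> 'a \<times> 'a \<times> 'a" where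
  "vadd K (x, y, z) (x', y', z') = (x \<oplus>\<^bsub>K\<^esub> x', y \<oplus>\<^bsub>K\<^esub> y', z \<oplus>\<^bsub>K\<^esub> z')"

fun vscale :: "'a ring \<Rightarrow> 'a \<Rightarrow> 'a \<times> 'a \<times> 'a \<Rightarrow> 'a \<times> 'a \<times> 'a" where
  "vscale K t (x, y, z) = (t \<otimes>\<^bsub>K\<^esub> x, t \<otimes>\<^bsub>K\<^esub> y, t \<otimes>\<^bsub>K\<^esub> z)"

definition lin_indep2 :: "'a ring \<Rightarrow> 'a \<times> 'a \<times> 'a \<Rightarrow> 'a \<times> 'a \<times> 'a \<Rightarrow> bool" where
  "lin_indep2 K u v \<longleftrightarrow>
    (\<forall>s\<in>carrier K. \<forall>t\<in>carrier K.
      vadd K (vscale K s u) (vscale K t v) = vzero K \<longrightarrow> s = \<zero>\<^bsub>K\<^esub> \<and> t = \<zero>\<^bsub>K\<^esub>)"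

text \<open>
  An affine subspace of dimension 1 (resp. 2) is a translate of the linear span of one nonzero
  vector (resp. of two linearly independent vectors).
\<close>

definition lines3 :: "'a ring \<Rightarrow> ('a \<times> 'a \<times> 'a) set set" where
  "lines3 K =
    {{vadd K p (vscale K t d) | t. t \<in> carrier K} | p d.
      p \<in> space3 K \<and> d \<in> space3 K \<and> d \<noteq> vzero K}"

definition planes3 :: "'a ring \<Rightarrow> ('a \<times> 'a \<times> 'a) set set" where
  "planes3 K =
    {{vadd K p (vadd K (vscale K s u) (vscale K t v)) | s t. s \<in> carrier K \<and> t \<in> carrier K} | p u v.
      p \<in> space3 K \<and> u \<in> space3 K \<and> v \<in> space3 K \<and> lin_indep2 K u v}"

definition points_on :: "('a \<times> 'a \<times> 'a) set set \<Rightarrow> ('a \<times> 'a \<times> 'a) set" where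
  "points_on L = \<Union>L"

definition nikodym :: "'a ring \<Rightarrow> ('a \<times> 'a \<times> 'a) set \<Rightarrow> bool" where
  "nikodym K N \<longleftrightarrow> N \<subseteq> space3 K \<and>
    (\<forall>p\<in>space3 K. \<exists>l\<in>lines3 K. p \<in> l \<and> l - {p} \<subseteq> N)"

definition finite_field :: "'a ring \<Rightarrow> bool" where
  "finite_field K \<longleftrightarrow> field K \<and> finite (carrier K)"

end

(*
  Let B be the complement of a Nikodym set N, and suppose |B| > eps q^3. Every p in B lies on a
  line l(p) that meets B in p only, so these lines are distinct. The lines l(p) with p in a fixed
  fraction of B miss the rest of B, which contradicts the covering hypothesis provided
  that few of the lines used lie in a common plane.

  Linear functionals form a universal hash family: the fibres of a random functional meet a set S
  in |S|/q points on average, and the squared deviations from this value, summed over the q fibres,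
  are at most |S| in expectation. Applied to B in space, this shows that all but O(q) planes contain
  at least (eps/2) q^2 points of B. Applied to the b points of B in a plane, where each tangent line
  is an exceptional fibre, it shows that the plane contains O(q^3/b) of the lines l(p) if b >= 2q,
  hence O(q) if b >= (eps/2) q^2. In any case it contains O(q^(3/2)) of them, since there are also at
  most b; so discarding all lines in the O(q) sparse planes costs only O(q^(5/2)) lines.
*)
theory Submission
  imports Defs "HOL-Algebra.Multiplicative_Group" "HOL-Algebra.Weak_Morphisms"
begin

section \<open>Second moments of fibre sizes in a universal hash family\<close>

text \<open>The squared fibre sizes of \<open>F a\<close> add up to the number of pairs in
  \<open>S\<close> that collide under \<open>F a\<close>. An off-diagonal pair collides for at most
  a fraction \<open>1 / card Q\<close> of all \<open>a\<close>, which the squared mean cancels; what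
  survives is the diagonal.\<close>

lemma sum_fibre_deviation:
  fixes F :: "'a \<Rightarrow> 'x \<Rightarrow> 'c"
  assumes fin: "finite A" "finite Q" "finite S" and Q: "Q \<noteq> {}"
    and F: "\<And>a x. a \<in> A \<Longrightarrow> x \<in> S \<Longrightarrow> F a x \<in> Q"
    and collisions: "\<And>x y. x \<in> S \<Longrightarrow> y \<in> S \<Longrightarrow> x \<noteq> y \<Longrightarrow>
      card {a \<in> A. F a x = F a y} * card Q \<le> card A"
  shows "(\<Sum>a\<in>A. \<Sum>c\<in>Q. (real (card {x \<in> S. F a x = c}) - card S / card Q)\<^sup>2)
    \<le> real (card A) * card S"
proof -
  define n where "n a c = real (card {x \<in> S. F a x = c})" for a c
  define s q where "s = real (card S)" and "q = real (card Q)"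
  have q0: "q > 0" using fin Q by (simp add: q_def card_gt_0_iff)
  have n_sum: "n a c = (\<Sum>x\<in>S. of_bool (F a x = c))" for a c
    using fin by (simp add: n_def Int_def)
  have sum_n: "(\<Sum>c\<in>Q. n a c) = s" if "a \<in> A" for a
  proof -
    have "(\<Sum>c\<in>Q. n a c) = (\<Sum>x\<in>S. \<Sum>c\<in>Q. of_bool (F a x = c))"
      unfolding n_sum by (rule sum.swap)
    also have "\<dots> = (\<Sum>x\<in>S. 1)"
    proof (rule sum.cong)
      fix x assume "x \<in> S"
      then have "Q \<inter> {c. F a x = c} = {F a x}" using F that by auto
      then show "(\<Sum>c\<in>Q. of_bool (F a x = c)) = (1::real)" using fin by simp
    qed simp
    finally show ?thesis by (simp add: s_def)
  qed
  have sum_n2: "(\<Sum>c\<in>Q. (n a c)\<^sup>2) = (\<Sum>x\<in>S. \<Sum>y\<in>S. of_bool (F a x = F a y))"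
    if "a \<in> A" for a
  proof -
    have "(\<Sum>c\<in>Q. (n a c)\<^sup>2)
        = (\<Sum>c\<in>Q. \<Sum>x\<in>S. \<Sum>y\<in>S. of_bool (F a x = c) * of_bool (F a y = c))"
      by (simp add: n_sum power2_eq_square sum_product)
    also have "\<dots> = (\<Sum>x\<in>S. \<Sum>c\<in>Q. \<Sum>y\<in>S. of_bool (F a x = c) * of_bool (F a y = c))"
      by (rule sum.swap)
    also have "\<dots> = (\<Sum>x\<in>S. \<Sum>y\<in>S. \<Sum>c\<in>Q. of_bool (F a x = c) * of_bool (F a y = c))"
      by (intro sum.cong refl sum.swap)
    also have "\<dots> = (\<Sum>x\<in>S. \<Sum>y\<in>S. of_bool (F a x = F a y))"
    proof (intro sum.cong refl)
      fix x y assume "x \<in> S" "y \<in> S"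
      then have "Q \<inter> {c. F a x = c \<and> F a y = c} = (if F a x = F a y then {F a x} else {})"
        using F that by auto
      then show "(\<Sum>c\<in>Q. of_bool (F a x = c) * of_bool (F a y = c))
          = (of_bool (F a x = F a y) :: real)"
        using fin by (simp flip: of_bool_conj)
    qed
    finally show ?thesis .
  qed
  have dev: "(\<Sum>c\<in>Q. (n a c - s / q)\<^sup>2) = (\<Sum>x\<in>S. \<Sum>y\<in>S. of_bool (F a x = F a y)) - s\<^sup>2 / q"
    if "a \<in> A" for a
  proof -
    have "(\<Sum>c\<in>Q. (n a c - s / q)\<^sup>2) = (\<Sum>c\<in>Q. (n a c)\<^sup>2 - 2 * s / q * n a c + (s / q)\<^sup>2)"
      by (intro sum.cong) (auto simp: power2_eq_square algebra_simps)
    also have "\<dots> = (\<Sum>c\<in>Q. (n a c)\<^sup>2) - 2 * s / q * (\<Sum>c\<in>Q. n a c) + q * (s / q)\<^sup>2"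
      by (simp add: sum.distrib sum_subtractf sum_distrib_left q_def)
    also have "\<dots> = (\<Sum>c\<in>Q. (n a c)\<^sup>2) - s\<^sup>2 / q"
      using q0 by (simp add: sum_n[OF that] power2_eq_square field_simps)
    finally show ?thesis by (simp add: sum_n2[OF that])
  qed
  \<comment> \<open>Diagonal pairs are granted the summand \<open>card A / q\<close> as well: its
    sum over all pairs then equals the term subtracted in \<open>dev\<close>, summed over
    \<open>A\<close>.\<close>
  have pair: "(\<Sum>a\<in>A. of_bool (F a x = F a y)) \<le> card A / q + (if x = y then real (card A) else 0)"
    if "x \<in> S" "y \<in> S" for x y
  proof (cases "x = y")
    case True
    then show ?thesis using q0 by simp
  next
    case False
    from collisions[OF that False] have "real (card {a \<in> A. F a x = F a y}) * q \<le> card A"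
      unfolding q_def by (metis of_nat_le_iff of_nat_mult)
    then show ?thesis using False q0 fin by (simp add: field_simps Int_def)
  qed
  have "(\<Sum>a\<in>A. \<Sum>c\<in>Q. (n a c - s / q)\<^sup>2)
      = (\<Sum>a\<in>A. (\<Sum>x\<in>S. \<Sum>y\<in>S. of_bool (F a x = F a y)) - s\<^sup>2 / q)"
    by (intro sum.cong refl dev)
  also have "\<dots> = (\<Sum>x\<in>S. \<Sum>a\<in>A. \<Sum>y\<in>S. of_bool (F a x = F a y)) - card A * (s\<^sup>2 / q)"
    by (simp add: sum_subtractf sum.swap[of _ A])
  also have "(\<Sum>x\<in>S. \<Sum>a\<in>A. \<Sum>y\<in>S. of_bool (F a x = F a y))
      = (\<Sum>x\<in>S. \<Sum>y\<in>S. \<Sum>a\<in>A. (of_bool (F a x = F a y) :: real))"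
    by (intro sum.cong refl sum.swap)
  also have "\<dots> \<le> (\<Sum>x\<in>S. \<Sum>y\<in>S. card A / q + (if x = y then real (card A) else 0))"
    by (intro sum_mono pair)
  also have "\<dots> = s * s * (card A / q) + s * card A"
    using fin by (simp add: sum.distrib s_def distrib_left)
  finally show ?thesis
    unfolding n_def s_def q_def by (simp add: power2_eq_square field_simps)
qed

text \<open>A Markov-type argument: a pair \<open>(a, c)\<close> determines its fibre, so different
  members of \<open>T\<close> own disjoint sets \<open>R t\<close> of pairs, and each accounts for
  at least \<open>m * D\<close> of the total deviation. The fibres are taken in an ambient set
  \<open>X\<close>, which will be the whole space or a single plane.\<close>

lemma card_deviating_fibres:
  fixes F :: "'a \<Rightarrow> 'x \<Rightarrow> 'c" and m D :: real
  assumes fin: "finite A" "finite Q" "finite S" "finite T" and Q: "Q \<noteq> {}"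
    and F: "\<And>a x. a \<in> A \<Longrightarrow> x \<in> S \<Longrightarrow> F a x \<in> Q"
    and collisions: "\<And>x y. x \<in> S \<Longrightarrow> y \<in> S \<Longrightarrow> x \<noteq> y \<Longrightarrow>
      card {a \<in> A. F a x = F a y} * card Q \<le> card A"
    and SX: "S \<subseteq> X"
    and R: "\<And>t. t \<in> T \<Longrightarrow> R t \<subseteq> A \<times> Q" "\<And>t. t \<in> T \<Longrightarrow> m \<le> card (R t)"
    and fibre: "\<And>t a c. t \<in> T \<Longrightarrow> (a, c) \<in> R t \<Longrightarrow> {x \<in> X. F a x = c} = t"
    and D: "D \<ge> 0" "\<And>t. t \<in> T \<Longrightarrow> D \<le> (real (card (t \<inter> S)) - card S / card Q)\<^sup>2"
  shows "card T * (m * D) \<le> real (card A) * card S"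
proof -
  define g where "g = (\<lambda>(a, c). (real (card {x \<in> S. F a x = c}) - card S / card Q)\<^sup>2)"
  have finR: "finite (R t)" if "t \<in> T" for t
    using R(1)[OF that] fin by (meson finite_SigmaI finite_subset)
  have "card T * (m * D) \<le> (\<Sum>t\<in>T. card (R t) * D)"
    using R(2) D(1) by (simp add: sum_bounded_below mult_right_mono)
  also have "\<dots> = (\<Sum>t\<in>T. \<Sum>_\<in>R t. D)" by simp
  also have "\<dots> \<le> (\<Sum>t\<in>T. \<Sum>p\<in>R t. g p)"
  proof (intro sum_mono)
    fix t p assume t: "t \<in> T" and p: "p \<in> R t"
    obtain a c where ac: "p = (a, c)" by force
    with fibre[OF t] p have "{x \<in> X. F a x = c} = t" by blast
    then have "t \<inter> S = {x \<in> S. F a x = c}" using SX by blast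
    then show "D \<le> g p" using D(2)[OF t] by (simp add: g_def ac)
  qed
  also have "\<dots> = sum g (\<Union>t\<in>T. R t)"
  proof (rule sum.UNION_disjoint[symmetric])
    show "\<forall>i\<in>T. \<forall>j\<in>T. i \<noteq> j \<longrightarrow> R i \<inter> R j = {}"
    proof (intro ballI impI)
      fix t t' assume tt: "t \<in> T" "t' \<in> T" "t \<noteq> t'"
      then show "R t \<inter> R t' = {}"
        using fibre[OF tt(1)] fibre[OF tt(2)] by fastforce
    qed
  qed (use fin finR in auto)
  also have "\<dots> \<le> sum g (A \<times> Q)"
    using R(1) fin by (intro sum_mono2) (auto simp: g_def)
  also have "\<dots> = (\<Sum>a\<in>A. \<Sum>c\<in>Q. (real (card {x \<in> S. F a x = c}) - card S / card Q)\<^sup>2)"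
    by (simp add: g_def sum.cartesian_product)
  also have "\<dots> \<le> real (card A) * card S"
    by (rule sum_fibre_deviation[OF fin(1-3) Q F collisions])
  finally show ?thesis .
qed

section \<open>Vectors and linear functionals over a finite field\<close>

text \<open>Functionals are encoded by their coefficient vectors. The hash family is thus indexed by
  \<open>space3 K\<close> itself, and the symmetry of the pairing lets points and functionals change
  roles.\<close>

fun dot :: "'a ring \<Rightarrow> 'a \<times> 'a \<times> 'a \<Rightarrow> 'a \<times> 'a \<times> 'a \<Rightarrow> 'a" where
  "dot K (a, b, c) (x, y, z) =
    a \<otimes>\<^bsub>K\<^esub> x \<oplus>\<^bsub>K\<^esub> b \<otimes>\<^bsub>K\<^esub> y \<oplus>\<^bsub>K\<^esub> c \<otimes>\<^bsub>K\<^esub> z"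

fun vsub :: "'a ring \<Rightarrow> 'a \<times> 'a \<times> 'a \<Rightarrow> 'a \<times> 'a \<times> 'a \<Rightarrow> 'a \<times> 'a \<times> 'a" where
  "vsub K (x, y, z) (x', y', z') = (x \<ominus>\<^bsub>K\<^esub> x', y \<ominus>\<^bsub>K\<^esub> y', z \<ominus>\<^bsub>K\<^esub> z')"

locale finite_field_space = field K for K :: "'a ring" (structure) +
  assumes finite_carrier: "finite (carrier K)"
begin

abbreviation V :: "('a \<times> 'a \<times> 'a) set" where "V \<equiv> space3 K"
abbreviation q :: nat where "q \<equiv> order K"

lemma card_carrier: "card (carrier K) = q"
  by (simp add: order_def)

lemma q_gt_1: "q > 1"
proof -
  have "card {\<zero>, \<one>} \<le> card (carrier K)"
    using finite_carrier by (intro card_mono) auto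
  then show ?thesis by (simp add: order_def)
qed

lemma finite_V: "finite V"
  using finite_carrier by (simp add: space3_def)

lemma card_V: "card V = q ^ 3"
  by (simp add: space3_def card_cartesian_product card_carrier power3_eq_cube)

lemma V_cases:
  assumes "v \<in> V"
  obtains x y z where "v = (x, y, z)" "x \<in> carrier K" "y \<in> carrier K" "z \<in> carrier K"
  using assms by (auto simp: space3_def)

lemma space3_closed [simp]:
  "vzero K \<in> V"
  "x \<in> V \<Longrightarrow> y \<in> V \<Longrightarrow> vadd K x y \<in> V"
  "x \<in> V \<Longrightarrow> y \<in> V \<Longrightarrow> vsub K x y \<in> V"
  "s \<in> carrier K \<Longrightarrow> x \<in> V \<Longrightarrow> vscale K s x \<in> V"
  "x \<in> V \<Longrightarrow> y \<in> V \<Longrightarrow> dot K x y \<in> carrier K"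
  by (auto simp: space3_def vzero_def)

lemma dot_commute: "a \<in> V \<Longrightarrow> x \<in> V \<Longrightarrow> dot K a x = dot K x a"
  by (auto simp: space3_def m_comm)

lemma dot_linear [simp]:
  assumes "a \<in> V" "x \<in> V"
  shows "y \<in> V \<Longrightarrow> dot K a (vadd K x y) = dot K a x \<oplus> dot K a y"
    and "y \<in> V \<Longrightarrow> dot K a (vsub K x y) = dot K a x \<ominus> dot K a y"
    and "s \<in> carrier K \<Longrightarrow> dot K a (vscale K s x) = s \<otimes> dot K a x"
    and "b \<in> V \<Longrightarrow> dot K (vsub K a b) x = dot K a x \<ominus> dot K b x"
  using assms
  by (auto simp: space3_def r_distr l_distr minus_eq r_minus l_minus minus_add a_ac m_ac)

lemma vsub_eq_zero_iff: "x \<in> V \<Longrightarrow> y \<in> V \<Longrightarrow> vsub K x y = vzero K \<longleftrightarrow> x = y"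
  by (auto simp: space3_def vzero_def)

lemma vsub_right_inj: "inj_on (\<lambda>x. vsub K x y) V" if "y \<in> V"
  using that by (auto simp: inj_on_def space3_def minus_eq)

lemma a_left_cancel:
  "x \<in> carrier K \<Longrightarrow> y \<in> carrier K \<Longrightarrow> z \<in> carrier K \<Longrightarrow> x \<oplus> y = x \<oplus> z \<longleftrightarrow> y = z"
  by (metis a_comm add.right_cancel)

lemma vadd_left_inj: "p \<in> V \<Longrightarrow> inj_on (vadd K p) V"
  by (auto simp: inj_on_def space3_def a_left_cancel)

lemma affine_eq_unique:
  assumes "a \<in> carrier K" "a \<noteq> \<zero>" "x \<in> carrier K" "x' \<in> carrier K" "r \<in> carrier K"
    and "a \<otimes> x \<oplus> r = a \<otimes> x' \<oplus> r"
  shows "x = x'"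
  using assms by (metis add.right_cancel m_closed m_lcancel)

declare vadd.simps [simp del] vscale.simps [simp del] vsub.simps [simp del]

text \<open>Some coefficient of \<open>a\<close> is nonzero, and the equation determines the
  corresponding coordinate from the other two; forgetting that coordinate is therefore
  injective.\<close>

lemma card_hyperplane:
  assumes a: "a \<in> V" "a \<noteq> vzero K"
  shows "card {x \<in> V. dot K a x = c} \<le> q ^ 2"
proof -
  obtain a1 a2 a3 where a_eq: "a = (a1, a2, a3)"
    and aK: "a1 \<in> carrier K" "a2 \<in> carrier K" "a3 \<in> carrier K"
    using a(1) by (rule V_cases)
  have main: "card H \<le> q ^ 2"
    if "inj_on f H" "f ` H \<subseteq> carrier K \<times> carrier K" for H and f :: "_ \<Rightarrow> 'a \<times> 'a"
  proof -
    have "card H \<le> card (carrier K \<times> carrier K)"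
      using that finite_carrier by (intro card_inj_on_le) auto
    then show ?thesis by (simp add: card_cartesian_product card_carrier power2_eq_square)
  qed
  consider "a1 \<noteq> \<zero>" | "a2 \<noteq> \<zero>" | "a3 \<noteq> \<zero>"
    using a(2) by (auto simp: a_eq vzero_def)
  then show ?thesis
  proof cases
    case 1
    show ?thesis
    proof (rule main[of "\<lambda>(x, y, z). (y, z)"])
      show "inj_on (\<lambda>(x, y, z). (y, z)) {x \<in> V. dot K a x = c}"
      proof (rule inj_onI)
        fix v w
        assume vw: "v \<in> {x \<in> V. dot K a x = c}" "w \<in> {x \<in> V. dot K a x = c}"
          and eq: "(\<lambda>(x, y, z). (y, z)) v = (\<lambda>(x, y, z). (y, z)) w"
        from vw have "v \<in> V" "w \<in> V" by auto
        then obtain x y z x' y' z' where "v = (x, y, z)" "w = (x', y', z')"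
          "x \<in> carrier K" "y \<in> carrier K" "z \<in> carrier K"
          "x' \<in> carrier K" "y' \<in> carrier K" "z' \<in> carrier K"
          by (metis V_cases)
        then show "v = w"
          using vw eq aK 1 affine_eq_unique[of a1 x x' "a2 \<otimes> y \<oplus> a3 \<otimes> z"]
          by (auto simp: a_eq a_ac)
      qed
    qed (auto simp: space3_def)
  next
    case 2
    show ?thesis
    proof (rule main[of "\<lambda>(x, y, z). (x, z)"])
      show "inj_on (\<lambda>(x, y, z). (x, z)) {x \<in> V. dot K a x = c}"
      proof (rule inj_onI)
        fix v w
        assume vw: "v \<in> {x \<in> V. dot K a x = c}" "w \<in> {x \<in> V. dot K a x = c}"
          and eq: "(\<lambda>(x, y, z). (x, z)) v = (\<lambda>(x, y, z). (x, z)) w"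
        from vw have "v \<in> V" "w \<in> V" by auto
        then obtain x y z x' y' z' where "v = (x, y, z)" "w = (x', y', z')"
          "x \<in> carrier K" "y \<in> carrier K" "z \<in> carrier K"
          "x' \<in> carrier K" "y' \<in> carrier K" "z' \<in> carrier K"
          by (metis V_cases)
        then show "v = w"
          using vw eq aK 2 affine_eq_unique[of a2 y y' "a1 \<otimes> x \<oplus> a3 \<otimes> z"]
          by (auto simp: a_eq a_ac)
      qed
    qed (auto simp: space3_def)
  next
    case 3
    show ?thesis
    proof (rule main[of "\<lambda>(x, y, z). (x, y)"])
      show "inj_on (\<lambda>(x, y, z). (x, y)) {x \<in> V. dot K a x = c}"
      proof (rule inj_onI)
        fix v w
        assume vw: "v \<in> {x \<in> V. dot K a x = c}" "w \<in> {x \<in> V. dot K a x = c}"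
          and eq: "(\<lambda>(x, y, z). (x, y)) v = (\<lambda>(x, y, z). (x, y)) w"
        from vw have "v \<in> V" "w \<in> V" by auto
        then obtain x y z x' y' z' where "v = (x, y, z)" "w = (x', y', z')"
          "x \<in> carrier K" "y \<in> carrier K" "z \<in> carrier K"
          "x' \<in> carrier K" "y' \<in> carrier K" "z' \<in> carrier K"
          by (metis V_cases)
        then show "v = w"
          using vw eq aK 3 affine_eq_unique[of a3 z z' "a1 \<otimes> x \<oplus> a2 \<otimes> y"]
          by (auto simp: a_eq a_ac)
      qed
    qed (auto simp: space3_def)
  qed
qed

text \<open>Universality of the hash family: \<open>a\<close> agrees on \<open>x\<close> and
  \<open>y\<close> iff it annihilates the nonzero vector \<open>vsub K x y\<close>, so by symmetry
  the colliding functionals form a hyperplane.\<close>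

lemma card_collisions:
  assumes "x \<in> V" "y \<in> V" "x \<noteq> y"
  shows "card {a \<in> V. dot K a x = dot K a y} * card (carrier K) \<le> card V"
proof -
  have "{a \<in> V. dot K a x = dot K a y} = {a \<in> V. dot K (vsub K x y) a = \<zero>}"
    using assms by (auto simp: dot_commute[of _ x] dot_commute[of _ y])
  moreover have "card {a \<in> V. dot K (vsub K x y) a = \<zero>} \<le> q ^ 2"
    using assms by (intro card_hyperplane) (auto simp: vsub_eq_zero_iff)
  ultimately show ?thesis
    by (simp add: card_V card_carrier power3_eq_cube power2_eq_square)
qed

text \<open>A substitute for rank-nullity. Subtracting a fixed member from a fibre of
  \<open>H\<close> maps the fibre injectively into the vectors with \<open>P\<close>, and at most
  \<open>card W\<close> fibres cover \<open>V\<close>. In the applications \<open>H\<close>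
  evaluates functionals at given vectors and \<open>P\<close> says that they vanish there.\<close>

lemma card_kernel_ge:
  assumes W: "finite W" "H ` V \<subseteq> W"
    and H: "\<And>a b. a \<in> V \<Longrightarrow> b \<in> V \<Longrightarrow> H a = H b \<Longrightarrow> P (vsub K a b)"
  shows "card V \<le> card W * card {a \<in> V. P a}"
proof -
  have fibre: "card {a \<in> V. H a = w} \<le> card {a \<in> V. P a}" for w
  proof (cases "\<exists>b\<in>V. H b = w")
    case True
    then obtain b where b: "b \<in> V" "H b = w" by blast
    show ?thesis
    proof (rule card_inj_on_le[of "\<lambda>a. vsub K a b"])
      show "inj_on (\<lambda>a. vsub K a b) {a \<in> V. H a = w}"
        using vsub_right_inj[OF b(1)] by (rule inj_on_subset) auto
    next
      show "(\<lambda>a. vsub K a b) ` {a \<in> V. H a = w} \<subseteq> {a \<in> V. P a}"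
      proof (rule image_subsetI)
        fix a assume "a \<in> {a \<in> V. H a = w}"
        then show "vsub K a b \<in> {a \<in> V. P a}" using b H[of a b] by simp
      qed
    qed (use finite_V in simp)
  next
    case False
    then have empty: "{a \<in> V. H a = w} = {}" by blast
    show ?thesis unfolding empty by simp
  qed
  have "V = (\<Union>w\<in>W. {a \<in> V. H a = w})" using W(2) by auto
  then have "card V = card (\<Union>w\<in>W. {a \<in> V. H a = w})" by (rule arg_cong)
  also have "\<dots> \<le> (\<Sum>w\<in>W. card {a \<in> V. H a = w})"
    by (rule card_UN_le[OF W(1)])
  also have "\<dots> \<le> card W * card {a \<in> V. P a}"
    using sum_bounded_above[of W, OF fibre] by simp
  finally show ?thesis .
qed

lemma card_annihilator_ge:
  assumes "d \<in> V"
  shows "q ^ 2 \<le> card {a \<in> V. dot K a d = \<zero>}"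
proof -
  have "card V \<le> card (carrier K) * card {a \<in> V. dot K a d = \<zero>}"
    using assms finite_carrier
    by (intro card_kernel_ge[where H = "\<lambda>a. dot K a d"]) auto
  then show ?thesis
    using q_gt_1 by (simp add: card_V card_carrier power3_eq_cube power2_eq_square)
qed

lemma card_annihilator2_ge:
  assumes "u \<in> V" "v \<in> V"
  shows "q \<le> card {a \<in> V. dot K a u = \<zero> \<and> dot K a v = \<zero>}"
proof -
  have "card V \<le> card (carrier K \<times> carrier K) * card {a \<in> V. dot K a u = \<zero> \<and> dot K a v = \<zero>}"
    using assms finite_carrier
    by (intro card_kernel_ge[where H = "\<lambda>a. (dot K a u, dot K a v)"])
       auto
  then show ?thesis
    using q_gt_1 by (simp add: card_V card_carrier card_cartesian_product power3_eq_cube)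
qed

section \<open>Parametrisations and sizes of lines and planes\<close>

lemma lines3_cases:
  assumes "l \<in> lines3 K"
  obtains p d where "p \<in> V" "d \<in> V" "d \<noteq> vzero K"
    "l = (\<lambda>t. vadd K p (vscale K t d)) ` carrier K"
  using assms by (auto simp: lines3_def Setcompr_eq_image)

lemma planes3_cases:
  assumes "\<pi> \<in> planes3 K"
  obtains p u v where "p \<in> V" "u \<in> V" "v \<in> V" "lin_indep2 K u v"
    "\<pi> = (\<lambda>(s, t). vadd K p (vadd K (vscale K s u) (vscale K t v))) ` (carrier K \<times> carrier K)"
proof -
  from assms obtain p u v where *: "p \<in> V" "u \<in> V" "v \<in> V" "lin_indep2 K u v"
    and "\<pi> = {vadd K p (vadd K (vscale K s u) (vscale K t v)) | s t. s \<in> carrier K \<and> t \<in> carrier K}"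
    by (auto simp: planes3_def)
  then have "\<pi> = (\<lambda>(s, t). vadd K p (vadd K (vscale K s u) (vscale K t v))) ` (carrier K \<times> carrier K)"
    by auto
  with * show thesis by (rule that)
qed

lemma lines3_subset: "l \<in> lines3 K \<Longrightarrow> l \<subseteq> V"
  by (auto elim!: lines3_cases)

lemma planes3_subset: "\<pi> \<in> planes3 K \<Longrightarrow> \<pi> \<subseteq> V"
  by (auto elim!: planes3_cases)

lemma finite_lines3: "finite (lines3 K)"
  using lines3_subset finite_V by (meson PowI finite_Pow_iff finite_subset subsetI)

lemma finite_planes3: "finite (planes3 K)"
  using planes3_subset finite_V by (meson PowI finite_Pow_iff finite_subset subsetI)

lemma inj_line:
  assumes "p \<in> V" "d \<in> V" "d \<noteq> vzero K"
  shows "inj_on (\<lambda>t. vadd K p (vscale K t d)) (carrier K)"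
proof (rule inj_onI)
  fix s t assume st: "s \<in> carrier K" "t \<in> carrier K"
    and eq: "vadd K p (vscale K s d) = vadd K p (vscale K t d)"
  have "vscale K s d = vscale K t d"
    using vadd_left_inj[OF assms(1)] eq st assms(2) by (auto dest: inj_onD)
  moreover obtain x y z where d: "d = (x, y, z)"
    "x \<in> carrier K" "y \<in> carrier K" "z \<in> carrier K"
    using assms(2) by (rule V_cases)
  ultimately have "s \<otimes> x = t \<otimes> x" "s \<otimes> y = t \<otimes> y" "s \<otimes> z = t \<otimes> z"
    by (simp_all add: vscale.simps)
  moreover have "x \<noteq> \<zero> \<or> y \<noteq> \<zero> \<or> z \<noteq> \<zero>"
    using assms(3) d by (auto simp: vzero_def)
  ultimately show "s = t"
    using st d by (metis m_comm m_lcancel)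
qed

lemma card_line: "l \<in> lines3 K \<Longrightarrow> card l = q"
  by (auto elim!: lines3_cases simp: card_image[OF inj_line] card_carrier)

lemma inj_plane:
  assumes "p \<in> V" "u \<in> V" "v \<in> V" "lin_indep2 K u v"
  shows "inj_on (\<lambda>(s, t). vadd K p (vadd K (vscale K s u) (vscale K t v))) (carrier K \<times> carrier K)"
proof (rule inj_onI, clarify)
  fix s t s' t' assume st: "s \<in> carrier K" "t \<in> carrier K" "s' \<in> carrier K" "t' \<in> carrier K"
    and eq: "vadd K p (vadd K (vscale K s u) (vscale K t v))
      = vadd K p (vadd K (vscale K s' u) (vscale K t' v))"
  have "vadd K (vscale K s u) (vscale K t v) = vadd K (vscale K s' u) (vscale K t' v)"
    using vadd_left_inj[OF assms(1)] eq st assms(2,3) by (auto dest: inj_onD)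
  then have "vsub K (vadd K (vscale K s u) (vscale K t v)) (vadd K (vscale K s' u) (vscale K t' v))
      = vzero K"
    using st assms by (simp add: vsub_eq_zero_iff)
  also have "vsub K (vadd K (vscale K s u) (vscale K t v)) (vadd K (vscale K s' u) (vscale K t' v))
      = vadd K (vscale K (s \<ominus> s') u) (vscale K (t \<ominus> t') v)"
    using st assms(2,3)
    by (auto simp: space3_def vadd.simps vscale.simps vsub.simps l_distr l_minus minus_eq minus_add a_ac)
  finally show "s = s' \<and> t = t'"
    using assms(4) st unfolding lin_indep2_def by (metis minus_closed r_right_minus_eq)
qed

lemma card_plane: "\<pi> \<in> planes3 K \<Longrightarrow> card \<pi> = q ^ 2"
  by (auto elim!: planes3_cases
      simp: card_image[OF inj_plane] card_carrier card_cartesian_product power2_eq_square)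

text \<open>In the parameters \<open>(s, t)\<close> the functional is affine with a nonzero
  coefficient at \<open>s\<close> or at \<open>t\<close>; on a fibre, that parameter is determined
  by the other one.\<close>

lemma card_fibre_in_plane:
  assumes p: "p \<in> V" "u \<in> V" "v \<in> V" and a: "a \<in> V" "dot K a u \<noteq> \<zero> \<or> dot K a v \<noteq> \<zero>"
    and \<pi>: "\<pi> = (\<lambda>(s, t). vadd K p (vadd K (vscale K s u) (vscale K t v))) ` (carrier K \<times> carrier K)"
  shows "card {x \<in> \<pi>. dot K a x = c} \<le> q"
proof -
  define \<phi> where "\<phi> = (\<lambda>(s, t). vadd K p (vadd K (vscale K s u) (vscale K t v)))"
  define H where "H = {st \<in> carrier K \<times> carrier K. dot K a (\<phi> st) = c}"
  have finH: "finite H" using finite_carrier by (simp add: H_def)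
  have \<phi>: "dot K a (\<phi> (s, t)) = dot K a p \<oplus> (s \<otimes> dot K a u \<oplus> t \<otimes> dot K a v)"
    if "s \<in> carrier K" "t \<in> carrier K" for s t
    using p a that by (simp add: \<phi>_def)
  have cK: "dot K a p \<in> carrier K" "dot K a u \<in> carrier K" "dot K a v \<in> carrier K"
    using p a by auto
  have "{x \<in> \<pi>. dot K a x = c} = \<phi> ` H" by (auto simp: \<pi> H_def \<phi>_def)
  then have "card {x \<in> \<pi>. dot K a x = c} \<le> card H" by (simp add: card_image_le finH)
  also have "card H \<le> card (carrier K)"
    using a(2)
  proof
    assume u: "dot K a u \<noteq> \<zero>"
    show ?thesis
    proof (rule card_inj_on_le[of snd])
      show "inj_on snd H"
      proof (rule inj_onI)
        fix x y assume "x \<in> H" "y \<in> H" "snd x = snd y"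
        then obtain s s' t where st: "x = (s, t)" "y = (s', t)"
          "s \<in> carrier K" "s' \<in> carrier K" "t \<in> carrier K"
          "dot K a (\<phi> (s, t)) = dot K a (\<phi> (s', t))"
          unfolding H_def by (cases x, cases y) auto
        then have "s \<otimes> dot K a u = s' \<otimes> dot K a u"
          using cK by (simp add: \<phi> a_left_cancel)
        then show "x = y" using st cK u by (metis m_comm m_lcancel)
      qed
    qed (auto simp: H_def finite_carrier)
  next
    assume v: "dot K a v \<noteq> \<zero>"
    show ?thesis
    proof (rule card_inj_on_le[of fst])
      show "inj_on fst H"
      proof (rule inj_onI)
        fix x y assume "x \<in> H" "y \<in> H" "fst x = fst y"
        then obtain s t t' where st: "x = (s, t)" "y = (s, t')"
          "s \<in> carrier K" "t \<in> carrier K" "t' \<in> carrier K"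
          "dot K a (\<phi> (s, t)) = dot K a (\<phi> (s, t'))"
          unfolding H_def by (cases x, cases y) auto
        then have "t \<otimes> dot K a v = t' \<otimes> dot K a v"
          using cK by (simp add: \<phi> a_left_cancel)
        then show "x = y" using st cK v by (metis m_comm m_lcancel)
      qed
    qed (auto simp: H_def finite_carrier)
  qed
  finally show ?thesis by (simp add: card_carrier)
qed

lemma dot_plane:
  assumes "p \<in> V" "u \<in> V" "v \<in> V" "a \<in> V" "dot K a u = \<zero>" "dot K a v = \<zero>"
    and "x \<in> (\<lambda>(s, t). vadd K p (vadd K (vscale K s u) (vscale K t v))) ` (carrier K \<times> carrier K)"
  shows "dot K a x = dot K a p"
  using assms by auto

section \<open>Planes and lines as fibres of functionals\<close>

text \<open>At least \<open>q\<close> functionals annihilate both directions of the plane. Each of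
  them is constant on the plane, and all but the zero functional have the plane as a full
  fibre.\<close>

lemma card_plane_functionals:
  assumes "\<pi> \<in> planes3 K"
  shows "q - 1 \<le> card {(a, c) \<in> V \<times> carrier K. {x \<in> V. dot K a x = c} = \<pi>}"
proof -
  obtain p u v where p: "p \<in> V" "u \<in> V" "v \<in> V"
    and \<pi>: "\<pi> = (\<lambda>(s, t). vadd K p (vadd K (vscale K s u) (vscale K t v))) ` (carrier K \<times> carrier K)"
    using assms by (rule planes3_cases)
  define Z where "Z = {a \<in> V. dot K a u = \<zero> \<and> dot K a v = \<zero>}"
  have "q - 1 \<le> card Z - 1" using card_annihilator2_ge[OF p(2,3)] by (simp add: Z_def)
  also have "\<dots> \<le> card (Z - {vzero K})" by (simp add: card_Diff_singleton_if)
  also have "\<dots> \<le> card {(a, c) \<in> V \<times> carrier K. {x \<in> V. dot K a x = c} = \<pi>}"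
  proof (rule card_inj_on_le[of "\<lambda>a. (a, dot K a p)"])
    show "(\<lambda>a. (a, dot K a p)) ` (Z - {vzero K})
      \<subseteq> {(a, c) \<in> V \<times> carrier K. {x \<in> V. dot K a x = c} = \<pi>}"
    proof (rule image_subsetI)
      fix a assume "a \<in> Z - {vzero K}"
      then have a: "a \<in> V" "a \<noteq> vzero K" "dot K a u = \<zero>" "dot K a v = \<zero>"
        by (auto simp: Z_def)
      have "\<pi> \<subseteq> {x \<in> V. dot K a x = dot K a p}"
        using planes3_subset[OF assms] dot_plane[OF p a(1,3,4)] unfolding \<pi> by blast
      \<comment> \<open>Counting turns the inclusion into equality: the plane has
        \<open>q ^ 2\<close> points and a fibre of a nonzero functional has no more.\<close>
      then have "\<pi> = {x \<in> V. dot K a x = dot K a p}"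
        by (rule card_seteq[rotated])
           (use card_hyperplane[OF a(1,2)] card_plane[OF assms] finite_V in auto)
      then show "(a, dot K a p) \<in> {(a, c) \<in> V \<times> carrier K. {x \<in> V. dot K a x = c} = \<pi>}"
        using a(1) p(1) by simp
    qed
    show "finite {(a, c) \<in> V \<times> carrier K. {x \<in> V. dot K a x = c} = \<pi>}"
      by (rule finite_subset[of _ "V \<times> carrier K"]) (use finite_V finite_carrier in auto)
  qed (simp add: inj_on_def)
  finally show ?thesis .
qed

text \<open>The second-moment bound in the whole space, where the multiplicity \<open>m\<close> of a
  plane is \<open>q - 1\<close>.\<close>

lemma card_deviating_planes:
  fixes D :: real
  assumes S: "S \<subseteq> V" and T: "T \<subseteq> planes3 K" and D: "D \<ge> 0"
    "\<And>\<pi>. \<pi> \<in> T \<Longrightarrow> D \<le> (real (card (\<pi> \<inter> S)) - card S / q)\<^sup>2"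
  shows "card T * ((real q - 1) * D) \<le> real q ^ 3 * card S"
proof -
  have "card T * ((real q - 1) * D) \<le> real (card V) * card S"
  proof (rule card_deviating_fibres[where F = "dot K" and Q = "carrier K" and X = V
        and R = "\<lambda>\<pi>. {(a, c) \<in> V \<times> carrier K. {x \<in> V. dot K a x = c} = \<pi>}"])
    show "real q - 1 \<le> card {(a, c) \<in> V \<times> carrier K. {x \<in> V. dot K a x = c} = \<pi>}"
      if "\<pi> \<in> T" for \<pi>
      using card_plane_functionals[of \<pi>] that T by fastforce
    show "finite T" using T finite_planes3 by (rule finite_subset)
    show "finite S" using S finite_V by (rule finite_subset)
    show "card {a \<in> V. dot K a x = dot K a y} * card (carrier K) \<le> card V"
      if "x \<in> S" "y \<in> S" "x \<noteq> y" for x y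
      using card_collisions[of x y] that S by blast
    show "dot K a x \<in> carrier K" if "a \<in> V" "x \<in> S" for a x
      using that S by auto
    show "carrier K \<noteq> {}" by auto
    show "D \<le> (real (card (t \<inter> S)) - card S / card (carrier K))\<^sup>2" if "t \<in> T" for t
      using D(2)[OF that] by (simp add: card_carrier)
  qed (use S D finite_V finite_carrier in auto)
  then show ?thesis by (simp add: card_V)
qed

text \<open>The exact value is \<open>q\<close>. The cruder bound is enough to leave at least
  \<open>q ^ 2 / 2\<close> functionals that annihilate a line direction in a plane without being
  constant on the plane.\<close>

lemma card_annihilator2_le:
  assumes indep: "u \<in> V" "v \<in> V" "lin_indep2 K u v" and q: "q \<ge> 4"
  shows "2 * card {a \<in> V. dot K a u = \<zero> \<and> dot K a v = \<zero>} \<le> q ^ 2"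
proof -
  define Z where "Z = {a \<in> V. dot K a u = \<zero> \<and> dot K a v = \<zero>}"
  define \<pi> where "\<pi> = (\<lambda>(s, t). vadd K (vzero K) (vadd K (vscale K s u) (vscale K t v)))
    ` (carrier K \<times> carrier K)"
  have "\<pi> = {vadd K (vzero K) (vadd K (vscale K s u) (vscale K t v)) | s t.
      s \<in> carrier K \<and> t \<in> carrier K}"
    by (auto simp: \<pi>_def)
  then have \<pi>: "\<pi> \<in> planes3 K"
    unfolding planes3_def using indep space3_closed(1) by blast
  note \<pi>V = planes3_subset[OF \<pi>]
  have fin: "finite \<pi>" using \<pi>V finite_V by (rule finite_subset)
  have zero: "dot K a (vzero K) = \<zero>" if "a \<in> V" for a
    using that by (auto simp: space3_def vzero_def)
  \<comment> \<open>The span \<open>\<pi>\<close> of \<open>u\<close> and \<open>v\<close> is the zero fibre of every functional in \<open>Z\<close>, so the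
    second-moment bound for \<open>\<pi>\<close> itself limits the size of \<open>Z\<close>.\<close>
  have "card {\<pi>} * (card Z * (real q ^ 2 - q)\<^sup>2) \<le> real (card V) * card \<pi>"
  proof (rule card_deviating_fibres[where F = "dot K" and Q = "carrier K" and X = \<pi>
        and R = "\<lambda>_. (\<lambda>a. (a, \<zero>)) ` Z"])
    show "real (card Z) \<le> card ((\<lambda>a. (a, \<zero>)) ` Z)"
      by (simp add: card_image inj_on_def)
    show "{x \<in> \<pi>. dot K a x = c} = \<pi>'" if "(a, c) \<in> (\<lambda>a. (a, \<zero>)) ` Z" "\<pi>' \<in> {\<pi>}" for \<pi>' a c
    proof -
      have "a \<in> V" "dot K a u = \<zero>" "dot K a v = \<zero>" "c = \<zero>" using that by (auto simp: Z_def)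
      then have "dot K a x = c" if "x \<in> \<pi>" for x
        using dot_plane[of "vzero K" u v a x] that indep zero unfolding \<pi>_def by simp
      then show ?thesis using that(2) by auto
    qed
    show "card {a \<in> V. dot K a x = dot K a y} * card (carrier K) \<le> card V"
      if "x \<in> \<pi>" "y \<in> \<pi>" "x \<noteq> y" for x y
      using card_collisions[of x y] that \<pi>V by blast
    show "dot K a x \<in> carrier K" if "a \<in> V" "x \<in> \<pi>" for a x
      using that \<pi>V by auto
    show "carrier K \<noteq> {}" by auto
    show "(real q ^ 2 - q)\<^sup>2 \<le> (real (card (\<pi>' \<inter> \<pi>)) - card \<pi> / card (carrier K))\<^sup>2"
      if "\<pi>' \<in> {\<pi>}" for \<pi>'
      using that q by (simp add: card_plane[OF \<pi>] card_carrier power2_eq_square)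
  qed (auto simp: Z_def fin finite_V finite_carrier)
  then have *: "card Z * (real q ^ 2 - q)\<^sup>2 \<le> real q ^ 5"
    by (simp add: card_V card_plane[OF \<pi>] flip: power_add)
  have q4: "real q \<ge> 4" using q by simp
  \<comment> \<open>For \<open>q \<ge> 4\<close>, \<open>q\<close> is at most a quarter of
    \<open>q ^ 2\<close>. The resulting bound \<open>16 / 9 * q\<close> for \<open>card Z\<close>
    lies below \<open>q ^ 2 / 2\<close> for the same reason.\<close>
  have "(3/4 * real q ^ 2)\<^sup>2 \<le> (real q ^ 2 - q)\<^sup>2"
  proof (rule power_mono)
    have "4 * real q \<le> real q * real q" using q4 by (intro mult_right_mono) auto
    then show "3/4 * real q ^ 2 \<le> real q ^ 2 - q" by (simp add: power2_eq_square)
  qed simp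
  then have "card Z * (3/4 * real q ^ 2)\<^sup>2 \<le> real q ^ 5"
    using * by (meson mult_left_mono of_nat_0_le_iff order_trans)
  also have "(3/4 * real q ^ 2)\<^sup>2 = 9/16 * real q ^ 4"
    by (simp add: power_mult_distrib power_divide)
  finally have "real q ^ 4 * (9 * card Z) \<le> real q ^ 4 * (16 * q)"
    by (simp add: power_numeral_reduce algebra_simps)
  then have "9 * real (card Z) \<le> 16 * q" using q4 by simp
  moreover have "4 * real q \<le> real q * real q" using q4 by (intro mult_right_mono) auto
  ultimately have "2 * real (card Z) \<le> real q ^ 2" unfolding power2_eq_square by linarith
  then have "real (2 * card Z) \<le> real (q ^ 2)" by simp
  then show ?thesis unfolding Z_def of_nat_le_iff .
qed

text \<open>Of the at least \<open>q ^ 2\<close> functionals annihilating the direction of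
  \<open>l\<close>, at most \<open>q ^ 2 / 2\<close> are constant on the plane. Any other one has a
  fibre in the plane that contains \<open>l\<close> and has at most \<open>q\<close> points, hence
  equals \<open>l\<close>.\<close>

lemma card_line_functionals:
  assumes \<pi>: "\<pi> \<in> planes3 K" and l: "l \<in> lines3 K" "l \<subseteq> \<pi>" and q: "q \<ge> 4"
  shows "q ^ 2 \<le> 2 * card {(a, c) \<in> V \<times> carrier K. {x \<in> \<pi>. dot K a x = c} = l}"
proof -
  obtain p u v where p: "p \<in> V" "u \<in> V" "v \<in> V" and indep: "lin_indep2 K u v"
    and \<pi>_eq: "\<pi> = (\<lambda>(s, t). vadd K p (vadd K (vscale K s u) (vscale K t v))) ` (carrier K \<times> carrier K)"
    using \<pi> by (rule planes3_cases)
  obtain o' d where d: "o' \<in> V" "d \<in> V" and l_eq: "l = (\<lambda>t. vadd K o' (vscale K t d)) ` carrier K"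
    using l(1) by (rule lines3_cases)
  define Z where "Z = {a \<in> V. dot K a u = \<zero> \<and> dot K a v = \<zero>}"
  define Y where "Y = {a \<in> V. dot K a d = \<zero>}"
  have "q ^ 2 \<le> 2 * (card Y - card Z)"
    using card_annihilator2_le[OF p(2,3) indep q] card_annihilator_ge[OF d(2)]
    unfolding Y_def Z_def by linarith
  also have "card Y - card Z \<le> card (Y - Z)"
    by (rule diff_card_le_card_Diff) (simp add: Z_def finite_V)
  also have "\<dots> \<le> card {(a, c) \<in> V \<times> carrier K. {x \<in> \<pi>. dot K a x = c} = l}"
  proof (rule card_inj_on_le[of "\<lambda>a. (a, dot K a o')"])
    show "(\<lambda>a. (a, dot K a o')) ` (Y - Z)
      \<subseteq> {(a, c) \<in> V \<times> carrier K. {x \<in> \<pi>. dot K a x = c} = l}"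
    proof (rule image_subsetI)
      fix a assume "a \<in> Y - Z"
      then have a: "a \<in> V" "dot K a d = \<zero>" "dot K a u \<noteq> \<zero> \<or> dot K a v \<noteq> \<zero>"
        by (auto simp: Y_def Z_def)
      have "dot K a x = dot K a o'" if "x \<in> l" for x
        using that a d by (auto simp: l_eq)
      then have "l \<subseteq> {x \<in> \<pi>. dot K a x = dot K a o'}"
        using l(2) by blast
      then have "l = {x \<in> \<pi>. dot K a x = dot K a o'}"
        by (rule card_seteq[rotated])
           (use card_fibre_in_plane[OF p a(1,3) \<pi>_eq] card_line[OF l(1)]
              finite_subset[OF planes3_subset[OF \<pi>] finite_V] in auto)
      then show "(a, dot K a o') \<in> {(a, c) \<in> V \<times> carrier K. {x \<in> \<pi>. dot K a x = c} = l}"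
        using a(1) d(1) by simp
    qed
    show "finite {(a, c) \<in> V \<times> carrier K. {x \<in> \<pi>. dot K a x = c} = l}"
      by (rule finite_subset[of _ "V \<times> carrier K"]) (use finite_V finite_carrier in auto)
  qed (simp add: inj_on_def)
  finally show ?thesis by simp
qed

section \<open>Tangent lines in dense and in sparse planes\<close>

text \<open>The second-moment bound inside a plane: fibres average \<open>card S / q\<close> points
  of \<open>S\<close>, a tangent has one, and each line has multiplicity at least
  \<open>q ^ 2 / 2\<close>.\<close>

lemma card_tangents_in_plane:
  assumes \<pi>: "\<pi> \<in> planes3 K" and q: "q \<ge> 4" and S: "S \<subseteq> \<pi>"
    and T: "T \<subseteq> lines3 K" "\<And>l. l \<in> T \<Longrightarrow> l \<subseteq> \<pi>" "\<And>l. l \<in> T \<Longrightarrow> card (l \<inter> S) = 1"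
  shows "card T * (real q ^ 2 / 2 * (card S / q - 1)\<^sup>2) \<le> real q ^ 3 * card S"
proof -
  have "card T * (real q ^ 2 / 2 * (card S / q - 1)\<^sup>2) \<le> real (card V) * card S"
  proof (rule card_deviating_fibres[where F = "dot K" and Q = "carrier K" and X = \<pi>
        and R = "\<lambda>l. {(a, c) \<in> V \<times> carrier K. {x \<in> \<pi>. dot K a x = c} = l}"])
    have SV: "S \<subseteq> V" using S planes3_subset[OF \<pi>] by blast
    show "real q ^ 2 / 2 \<le> card {(a, c) \<in> V \<times> carrier K. {x \<in> \<pi>. dot K a x = c} = l}"
      if "l \<in> T" for l
    proof -
      have "q ^ 2 \<le> 2 * card {(a, c) \<in> V \<times> carrier K. {x \<in> \<pi>. dot K a x = c} = l}"
        using card_line_functionals[OF \<pi> _ _ q] that T(1,2) by blast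
      then have "real (q ^ 2) \<le> real (2 * card {(a, c) \<in> V \<times> carrier K. {x \<in> \<pi>. dot K a x = c} = l})"
        by (rule of_nat_mono)
      then show ?thesis by simp
    qed
    show "finite T" using T(1) finite_lines3 by (rule finite_subset)
    show "finite S" using SV finite_V by (rule finite_subset)
    show "card {a \<in> V. dot K a x = dot K a y} * card (carrier K) \<le> card V"
      if "x \<in> S" "y \<in> S" "x \<noteq> y" for x y
      using card_collisions[of x y] that SV by blast
    show "dot K a x \<in> carrier K" if "a \<in> V" "x \<in> S" for a x
      using that SV by auto
    show "carrier K \<noteq> {}" by auto
    show "(card S / q - 1)\<^sup>2 \<le> (real (card (t \<inter> S)) - card S / card (carrier K))\<^sup>2" if "t \<in> T" for t
      by (simp add: T(3)[OF that] card_carrier power2_commute)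
  qed (use S finite_V finite_carrier in auto)
  then show ?thesis by (simp add: card_V)
qed

text \<open>Let \<open>k\<close> tangents lie in a plane with \<open>b\<close> points of
  \<open>B\<close>. If \<open>b \<ge> 2 * q\<close>, the deviation \<open>b / q - 1\<close> is of
  order \<open>b / q\<close>, which bounds \<open>k * b\<close>. The points of tangency lie in the
  plane, so \<open>k \<le> b\<close>; hence \<open>k * k \<le> k * b\<close> in this case, and
  \<open>k < 2 * q\<close> otherwise.\<close>

lemma tangents_in_plane_bounds:
  assumes \<pi>: "\<pi> \<in> planes3 K" and q: "q \<ge> 4" and G: "G \<subseteq> B"
    and l: "inj_on l G" "\<And>p. p \<in> G \<Longrightarrow> l p \<in> lines3 K \<and> l p \<subseteq> \<pi> \<and> l p \<inter> B = {p}"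
  shows "2 * q \<le> card (\<pi> \<inter> B) \<Longrightarrow> real (card G) * card (\<pi> \<inter> B) \<le> 8 * real q ^ 3"
    and "real (card G) ^ 2 \<le> 8 * real q ^ 3"
proof -
  define b where "b = real (card (\<pi> \<inter> B))"
  define k where "k = real (card G)"
  have q4: "real q \<ge> 4" using q by simp
  have "finite (\<pi> \<inter> B)"
    using planes3_subset[OF \<pi>] finite_V by (meson finite_Int finite_subset)
  moreover have "G \<subseteq> \<pi> \<inter> B" using l(2) G by blast
  ultimately have kb: "k \<le> b" by (simp add: k_def b_def card_mono)
  have "card (l ` G) * (real q ^ 2 / 2 * (card (\<pi> \<inter> B) / q - 1)\<^sup>2) \<le> real q ^ 3 * card (\<pi> \<inter> B)"
  proof (rule card_tangents_in_plane[OF \<pi> q])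
    show "card (m \<inter> (\<pi> \<inter> B)) = 1" if m: "m \<in> l ` G" for m
    proof -
      obtain p where "m = l p" "l p \<subseteq> \<pi>" "l p \<inter> B = {p}" using m l(2) by blast
      then have "m \<inter> (\<pi> \<inter> B) = {p}" by blast
      then show ?thesis by simp
    qed
  qed (use l(2) in auto)
  then have main: "k * (real q ^ 2 / 2 * (b / q - 1)\<^sup>2) \<le> real q ^ 3 * b"
    by (simp add: card_image[OF l(1)] b_def k_def)
  have large: "k * b \<le> 8 * real q ^ 3" if "2 * real q \<le> b"
  proof -
    have b0: "b > 0" using that q4 by linarith
    \<comment> \<open>At least half of \<open>b / q\<close> survives the subtraction of 1. The
      square of this half and the factor 1/2 in the multiplicity produce the constant 8.\<close>
    have "(b / (2 * q))\<^sup>2 \<le> (b / q - 1)\<^sup>2"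
      using that q4 by (intro power_mono) (auto simp: field_simps)
    then have "k * (real q ^ 2 / 2 * (b / (2 * q))\<^sup>2) \<le> real q ^ 3 * b"
      using main by (smt (verit) k_def mult_left_mono of_nat_0_le_iff zero_le_divide_iff zero_le_power2)
    also have "k * (real q ^ 2 / 2 * (b / (2 * q))\<^sup>2) = k * b * b / 8"
      using q4 by (simp add: field_simps power2_eq_square)
    finally have "k * b * b \<le> 8 * real q ^ 3 * b" by simp
    then show ?thesis using b0 by simp
  qed
  then show "2 * q \<le> card (\<pi> \<inter> B) \<Longrightarrow> real (card G) * card (\<pi> \<inter> B) \<le> 8 * real q ^ 3"
    by (simp add: b_def k_def)
  have "k * k \<le> 8 * real q ^ 3"
  proof (cases "2 * real q \<le> b")
    case True
    have "k * k \<le> k * b" using kb by (simp add: k_def mult_left_mono)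
    then show ?thesis using large[OF True] by linarith
  next
    case False
    then have "k * k \<le> (2 * real q) * (2 * real q)" using kb by (intro mult_mono) (auto simp: k_def)
    also have "\<dots> = 4 * real q ^ 2" by (simp add: power2_eq_square)
    also have "\<dots> \<le> 8 * real q ^ 3" using q4 by (intro mult_mono power_increasing) auto
    finally show ?thesis .
  qed
  then show "real (card G) ^ 2 \<le> 8 * real q ^ 3" by (simp add: k_def power2_eq_square)
qed

text \<open>The mean number of points of \<open>B\<close> is at least
  \<open>\<epsilon> * q ^ 2\<close>, so a sparse plane falls short of it by at least half of that
  amount.\<close>

lemma card_sparse_planes:
  assumes eps: "\<epsilon> > 0" and B: "B \<subseteq> V" "\<epsilon> * real q ^ 3 \<le> card B" and q: "q \<ge> 4"
  shows "card {\<pi> \<in> planes3 K. card (\<pi> \<inter> B) < \<epsilon> / 2 * real q ^ 2} \<le> 8 * real q / \<epsilon> ^ 2"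
proof -
  define T where "T = {\<pi> \<in> planes3 K. card (\<pi> \<inter> B) < \<epsilon> / 2 * real q ^ 2}"
  have q4: "real q \<ge> 4" using q by simp
  have avg: "\<epsilon> * real q ^ 2 \<le> card B / q"
    using B(2) q4 by (simp add: field_simps power_numeral_reduce)
  have "card T * ((real q - 1) * (\<epsilon> / 2 * real q ^ 2)\<^sup>2) \<le> real q ^ 3 * card B"
  proof (rule card_deviating_planes[OF B(1)])
    fix \<pi> assume "\<pi> \<in> T"
    then have "real (card (\<pi> \<inter> B)) < \<epsilon> / 2 * real q ^ 2" by (simp add: T_def)
    then have "\<epsilon> / 2 * real q ^ 2 \<le> card B / q - real (card (\<pi> \<inter> B))"
      using avg by linarith
    then have "(\<epsilon> / 2 * real q ^ 2)\<^sup>2 \<le> (card B / q - real (card (\<pi> \<inter> B)))\<^sup>2"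
      using eps by (intro power_mono) auto
    then show "(\<epsilon> / 2 * real q ^ 2)\<^sup>2 \<le> (real (card (\<pi> \<inter> B)) - card B / q)\<^sup>2"
      by (simp add: power2_commute)
  qed (auto simp: T_def)
  also have "\<dots> \<le> real q ^ 3 * real q ^ 3"
    using card_mono[OF finite_V B(1)] by (intro mult_left_mono) (simp_all add: card_V flip: of_nat_power)
  finally have "card T * ((real q - 1) * (\<epsilon> / 2 * real q ^ 2)\<^sup>2) \<le> real q ^ 6"
    by (simp flip: power_add)
  \<comment> \<open>Replacing \<open>q - 1\<close> by \<open>q / 2\<close> turns the 4 from the
    squared deviation into 8.\<close>
  moreover have "card T * (real q / 2 * (\<epsilon> / 2 * real q ^ 2)\<^sup>2)
      \<le> card T * ((real q - 1) * (\<epsilon> / 2 * real q ^ 2)\<^sup>2)"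
    using q4 by (intro mult_left_mono mult_right_mono) auto
  ultimately have "card T * (real q / 2 * (\<epsilon> / 2 * real q ^ 2)\<^sup>2) \<le> real q ^ 6" by linarith
  then have "real q ^ 5 * (card T * \<epsilon> ^ 2) \<le> real q ^ 5 * (8 * q)"
    by (simp add: power_numeral_reduce field_simps)
  then have "card T * \<epsilon> ^ 2 \<le> 8 * q" using q4 by simp
  then have "card T \<le> 8 * real q / \<epsilon> ^ 2" using eps by (simp add: field_simps)
  then show ?thesis unfolding T_def .
qed

text \<open>At most \<open>8 * q / \<epsilon> ^ 2\<close> sparse planes, each with at most
  \<open>3 * q powr (3/2)\<close> tangents, contain O(q^(5/2)) of them; the condition on
  \<open>sqrt q\<close> makes this at most \<open>\<epsilon> / 2 * q ^ 3\<close>.\<close>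

lemma card_tangents_in_sparse_planes:
  assumes eps: "\<epsilon> > 0" and B: "B \<subseteq> V" "\<epsilon> * real q ^ 3 \<le> card B"
    and q: "q \<ge> 4" "48 / \<epsilon> ^ 3 \<le> sqrt (real q)"
    and l: "inj_on l B" "\<And>p. p \<in> B \<Longrightarrow> l p \<in> lines3 K \<and> l p \<inter> B = {p}"
  shows "card {p \<in> B. \<exists>\<pi>\<in>planes3 K. card (\<pi> \<inter> B) < \<epsilon> / 2 * real q ^ 2 \<and> l p \<subseteq> \<pi>}
    \<le> \<epsilon> / 2 * real q ^ 3"
proof -
  define T where "T = {\<pi> \<in> planes3 K. card (\<pi> \<inter> B) < \<epsilon> / 2 * real q ^ 2}"
  \<comment> \<open>Writing \<open>q\<close> as a square keeps the exponents 3/2 and 5/2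
    integral.\<close>
  define r where "r = sqrt (real q)"
  have qr: "real q = r\<^sup>2" by (simp add: r_def)
  have r0: "r > 0" using q by (simp add: r_def)
  have finT: "finite T" using finite_planes3 by (simp add: T_def)
  have finB: "finite B" using B(1) finite_V by (rule finite_subset)
  have per_plane: "real (card {p \<in> B. l p \<subseteq> \<pi>}) \<le> 3 * r ^ 3" if "\<pi> \<in> T" for \<pi>
  proof -
    have "real (card {p \<in> B. l p \<subseteq> \<pi>}) ^ 2 \<le> 8 * real q ^ 3"
      by (rule tangents_in_plane_bounds(2)[where l = l and B = B and \<pi> = \<pi>])
         (use that q(1) l in \<open>auto simp: T_def intro: inj_on_subset\<close>)
    also have "\<dots> \<le> (3 * r ^ 3)\<^sup>2" by (simp add: qr power_mult_distrib flip: power_mult)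
    finally show ?thesis by (rule power2_le_imp_le) (use r0 in simp)
  qed
  have "{p \<in> B. \<exists>\<pi>\<in>planes3 K. card (\<pi> \<inter> B) < \<epsilon> / 2 * real q ^ 2 \<and> l p \<subseteq> \<pi>}
      = (\<Union>\<pi>\<in>T. {p \<in> B. l p \<subseteq> \<pi>})" (is "?X = _") by (auto simp: T_def)
  then have "card ?X \<le> (\<Sum>\<pi>\<in>T. card {p \<in> B. l p \<subseteq> \<pi>})"
    using card_UN_le[OF finT] by simp
  then have "real (card ?X) \<le> (\<Sum>\<pi>\<in>T. real (card {p \<in> B. l p \<subseteq> \<pi>}))"
    by (simp flip: of_nat_sum)
  also have "\<dots> \<le> card T * (3 * r ^ 3)"
    using per_plane by (rule sum_bounded_above)
  also have "\<dots> \<le> 8 * real q / \<epsilon> ^ 2 * (3 * r ^ 3)"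
    using card_sparse_planes[OF eps B q(1)] r0 unfolding T_def by (intro mult_right_mono) auto
  also have "\<dots> = \<epsilon> / 2 * r ^ 5 * (48 / \<epsilon> ^ 3)"
    using eps by (simp add: qr field_simps power_numeral_reduce)
  also have "\<dots> \<le> \<epsilon> / 2 * r ^ 5 * r"
    using q(2) eps r0 by (intro mult_left_mono) (auto simp: r_def)
  also have "\<dots> = \<epsilon> / 2 * real q ^ 3" by (simp add: qr power_numeral_reduce)
  finally show ?thesis .
qed

section \<open>A line set violating the covering property\<close>

lemma few_coplanar_lines_missing_many_points:
  assumes N: "nikodym K N" and eps: "\<epsilon> > 0" and card_N: "card N \<le> (1 - \<epsilon>) * real q ^ 3"
    and q: "q \<ge> 4" "4 / \<epsilon> \<le> q" "48 / \<epsilon> ^ 3 \<le> sqrt (real q)"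
  obtains L where "L \<subseteq> lines3 K" "\<epsilon> / 4 * real q ^ 3 \<le> card L"
    "\<And>\<pi>. \<pi> \<in> planes3 K \<Longrightarrow> card {l \<in> L. l \<subseteq> \<pi>} \<le> 16 / \<epsilon> * real q"
    "card (points_on L) \<le> (1 - \<epsilon> / 2) * real q ^ 3"
proof -
  define B where "B = V - N"
  have NV: "N \<subseteq> V" using N by (simp add: nikodym_def)
  have BV: "B \<subseteq> V" by (simp add: B_def)
  have finB: "finite B" using finite_V by (simp add: B_def)
  have q4: "real q \<ge> 4" using q by simp
  have eq4: "\<epsilon> * q \<ge> 4" using q(2) eps by (simp add: field_simps)
  have "real (card B) = real q ^ 3 - card N"
    using card_Diff_subset[OF finite_subset[OF NV finite_V] NV] card_mono[OF finite_V NV]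
    by (simp add: B_def card_V of_nat_diff)
  then have card_B: "\<epsilon> * real q ^ 3 \<le> card B" using card_N by (simp add: algebra_simps)
  \<comment> \<open>The Nikodym line through \<open>p\<close> stays in \<open>N\<close> away from
    \<open>p\<close>, so it is tangent to the complement \<open>B\<close>. The point can be read off
    the line, which makes the chosen lines distinct.\<close>
  have "\<forall>p\<in>B. \<exists>l\<in>lines3 K. l \<inter> B = {p}"
  proof
    fix p assume p: "p \<in> B"
    then obtain l where "l \<in> lines3 K" "p \<in> l" "l - {p} \<subseteq> N"
      using N BV unfolding nikodym_def by blast
    then show "\<exists>l\<in>lines3 K. l \<inter> B = {p}" using p unfolding B_def by blast
  qed
  then obtain l where l: "\<And>p. p \<in> B \<Longrightarrow> l p \<in> lines3 K \<and> l p \<inter> B = {p}" by metis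
  have inj: "inj_on l B" by (rule inj_onI) (metis l singleton_inject)
  define X where "X = {p \<in> B. \<exists>\<pi>\<in>planes3 K. card (\<pi> \<inter> B) < \<epsilon> / 2 * real q ^ 2 \<and> l p \<subseteq> \<pi>}"
  have card_X: "card X \<le> \<epsilon> / 2 * real q ^ 3"
    unfolding X_def by (rule card_tangents_in_sparse_planes[OF eps BV card_B q(1,3) inj l])
  have XB: "X \<subseteq> B" by (auto simp: X_def)
  \<comment> \<open>About \<open>\<epsilon> / 4 * q ^ 3\<close> lines are enough for the size
    condition of the covering property, yet few enough to leave at least half of
    \<open>\<epsilon> * q ^ 3\<close> points of \<open>B\<close> uncovered.\<close>
  define n where "n = nat \<lceil>\<epsilon> / 4 * real q ^ 3\<rceil>"
  have n_ge: "\<epsilon> / 4 * real q ^ 3 \<le> n" by (simp add: n_def real_nat_ceiling_ge)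
  \<comment> \<open>Rounding up adds less than 1, which is at most
    \<open>\<epsilon> / 4 * q ^ 3\<close>; so \<open>n\<close> stays within what remains after the
    removal of \<open>X\<close>.\<close>
  have "1 \<le> \<epsilon> * q / 4 * real q ^ 2"
    using eq4 q4 mult_mono[of 1 "\<epsilon> * q / 4" 1 "real q ^ 2"] by (simp add: one_le_power)
  also have "\<dots> = \<epsilon> / 4 * real q ^ 3" by (simp add: power_numeral_reduce)
  finally have n_le: "n \<le> \<epsilon> / 2 * real q ^ 3" unfolding n_def by linarith
  have "card (B - X) = card B - card X"
    by (rule card_Diff_subset) (use XB finB finite_subset in auto)
  then have "real n \<le> card (B - X)"
    using n_le card_X card_B card_mono[OF finB XB] by (simp add: of_nat_diff)
  then obtain G where G: "G \<subseteq> B - X" "card G = n"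
    by (metis obtain_subset_with_card_n of_nat_le_iff)
  have GB: "G \<subseteq> B" using G by blast
  have inj_G: "inj_on l G" using inj GB by (rule inj_on_subset)
  show thesis
  proof (rule that)
    show "l ` G \<subseteq> lines3 K" using l GB by blast
    show "\<epsilon> / 4 * real q ^ 3 \<le> card (l ` G)" using n_ge by (simp add: card_image[OF inj_G] G)
    show "card {m \<in> l ` G. m \<subseteq> \<pi>} \<le> 16 / \<epsilon> * real q" if \<pi>: "\<pi> \<in> planes3 K" for \<pi>
    \<comment> \<open>Removing \<open>X\<close> leaves no chosen line in a sparse plane; in a dense
      plane the tangent bound applies.\<close>
    proof (cases "real (card (\<pi> \<inter> B)) < \<epsilon> / 2 * real q ^ 2")
      case True
      then have empty: "{m \<in> l ` G. m \<subseteq> \<pi>} = {}" using G(1) \<pi> by (auto simp: X_def)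
      show ?thesis unfolding empty using eps by simp
    next
      case False
      define H where "H = {p \<in> G. l p \<subseteq> \<pi>}"
      have "{m \<in> l ` G. m \<subseteq> \<pi>} = l ` H" by (auto simp: H_def)
      then have card_H: "card {m \<in> l ` G. m \<subseteq> \<pi>} = card H"
        using card_image inj_on_subset[OF inj_G, of H] by (auto simp: H_def)
      \<comment> \<open>The density \<open>\<epsilon> / 2 * q ^ 2\<close> reaches the threshold
        \<open>2 * q\<close> of the tangent bound. The constant \<open>16 / \<epsilon>\<close> is 8
        divided by \<open>\<epsilon> / 2\<close>.\<close>
      have "4 * real q \<le> \<epsilon> * q * q" using eq4 by (intro mult_right_mono) auto
      then have "2 * real q \<le> card (\<pi> \<inter> B)" using False by (simp add: power2_eq_square)
      then have "2 * q \<le> card (\<pi> \<inter> B)" by linarith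
      moreover have "H \<subseteq> B" using GB by (auto simp: H_def)
      moreover have "l p \<in> lines3 K \<and> l p \<subseteq> \<pi> \<and> l p \<inter> B = {p}" if "p \<in> H" for p
        using that l[of p] GB by (simp add: H_def subset_eq)
      ultimately have "real (card H) * card (\<pi> \<inter> B) \<le> 8 * real q ^ 3"
        using tangents_in_plane_bounds(1)[OF \<pi> q(1)] inj_on_subset[OF inj] by blast
      moreover have "real (card H) * (\<epsilon> / 2 * real q ^ 2) \<le> real (card H) * card (\<pi> \<inter> B)"
        using False by (intro mult_left_mono) auto
      ultimately have "real (card H) * (\<epsilon> / 2 * real q ^ 2) \<le> 8 * real q ^ 3" by linarith
      then have "real q ^ 2 * (card H * \<epsilon>) \<le> real q ^ 2 * (16 * q)"
        by (simp add: power_numeral_reduce field_simps)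
      then have "card H * \<epsilon> \<le> 16 * q" using q4 by simp
      then show ?thesis using eps by (simp add: card_H field_simps)
    qed
    \<comment> \<open>A chosen line meets \<open>B\<close> only in its own point, which belongs to
      \<open>G\<close>; all of \<open>B - G\<close> is missed.\<close>
    have "l p \<subseteq> V - (B - G)" if p: "p \<in> G" for p
    proof -
      have "p \<in> B" using p GB by (rule rev_subsetD)
      with l have "l p \<in> lines3 K" "l p \<inter> B = {p}" by simp_all
      then have "l p \<subseteq> V" "l p \<inter> (B - G) = {}"
        using p lines3_subset by (simp_all add: Diff_eq flip: Int_assoc)
      then show ?thesis by (simp only: Diff_eq le_inf_iff disjoint_eq_subset_Compl)
    qed
    then have "points_on (l ` G) \<subseteq> V - (B - G)"
      unfolding points_on_def by (rule UN_least)
    then have "card (points_on (l ` G)) \<le> card (V - (B - G))"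
      by (rule card_mono[rotated]) (simp add: finite_V)
    also have "card (V - (B - G)) = card V - card (B - G)"
      by (rule card_Diff_subset) (use BV finB in auto)
    also have "card (B - G) = card B - card G"
      using finite_subset[OF GB finB] GB by (rule card_Diff_subset)
    finally have "card (points_on (l ` G)) + card B \<le> q ^ 3 + n"
      using card_mono[OF finite_V BV] card_mono[OF finB GB] by (simp add: G card_V)
    then have "real (card (points_on (l ` G)) + card B) \<le> real (q ^ 3 + n)"
      by (rule of_nat_mono)
    then show "card (points_on (l ` G)) \<le> (1 - \<epsilon> / 2) * real q ^ 3"
      using n_le card_B by (simp add: algebra_simps)
  qed
qed

end

section \<open>Transport of Nikodym sets to fields of natural numbers\<close>

text \<open>Relabelling scalars by \<open>f\<close> is a ring isomorphism onto the image ring.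
  Applied coordinatewise it commutes with \<open>vadd\<close> and \<open>vscale\<close>, so it
  carries lines to lines.\<close>

lemma nikodym_image_ring:
  assumes K: "field K" and f: "inj_on f (carrier K)" and N: "nikodym K N"
  shows "nikodym (image_ring f K) (map_prod f (map_prod f f) ` N)"
proof -
  interpret field K by (rule K)
  define K' where "K' = image_ring f K"
  define F where "F = map_prod f (map_prod f f)"
  have f_iso: "f \<in> ring_iso K K'" unfolding K'_def using f by (rule inj_imp_image_ring_iso)
  then have f_hom: "f \<in> ring_hom K K'" by (simp add: ring_iso_def)
  have carrier': "carrier K' = f ` carrier K" by (simp add: K'_def image_ring_carrier)
  have zero': "\<zero>\<^bsub>K'\<^esub> = f \<zero>\<^bsub>K\<^esub>" by (simp add: K'_def image_ring_zero)
  have inj_F: "inj_on F (space3 K)"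
    unfolding F_def space3_def using f by (intro map_prod_inj_on)
  have space3': "space3 K' = F ` space3 K"
    by (simp add: space3_def F_def carrier' map_prod_surj_on[OF refl map_prod_surj_on[OF refl refl]])
  have F_vadd: "F (vadd K x y) = vadd K' (F x) (F y)" if "x \<in> space3 K" "y \<in> space3 K" for x y
    using that ring_hom_add[OF f_hom] by (auto simp: F_def space3_def)
  have F_vscale: "F (vscale K t x) = vscale K' (f t) (F x)" if "t \<in> carrier K" "x \<in> space3 K" for t x
    using that ring_hom_mult[OF f_hom] by (auto simp: F_def space3_def)
  have F_vzero: "F (vzero K) = vzero K'" by (simp add: F_def vzero_def zero')
  have vzero_closed: "vzero K \<in> space3 K" by (simp add: vzero_def space3_def)
  have vscale_closed: "vscale K t x \<in> space3 K" if "t \<in> carrier K" "x \<in> space3 K" for t x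
    using that by (auto simp: space3_def)
  have F_line: "F ` l \<in> lines3 K'" if "l \<in> lines3 K" for l
  proof -
    from that obtain p d where pd: "p \<in> space3 K" "d \<in> space3 K" "d \<noteq> vzero K"
      and l: "l = {vadd K p (vscale K t d) | t. t \<in> carrier K}"
      by (auto simp: lines3_def)
    have "F ` l = (\<lambda>t. F (vadd K p (vscale K t d))) ` carrier K"
      by (simp add: l Setcompr_eq_image image_image)
    also have "\<dots> = (\<lambda>t. vadd K' (F p) (vscale K' (f t) (F d))) ` carrier K"
      using pd by (intro image_cong) (simp_all add: F_vadd F_vscale vscale_closed)
    also have "\<dots> = {vadd K' (F p) (vscale K' t (F d)) | t. t \<in> carrier K'}"
      by (auto simp: carrier')
    finally have "F ` l = {vadd K' (F p) (vscale K' t (F d)) | t. t \<in> carrier K'}" .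
    moreover have "F d \<noteq> vzero K'"
      using inj_F pd vzero_closed by (metis F_vzero inj_onD)
    ultimately show ?thesis
      using pd unfolding lines3_def space3' by blast
  qed
  have "nikodym K' (F ` N)"
    unfolding nikodym_def
  proof (intro conjI ballI)
    show "F ` N \<subseteq> space3 K'" using N unfolding nikodym_def space3' by blast
    fix p' assume "p' \<in> space3 K'"
    then obtain p where p: "p \<in> space3 K" "p' = F p" unfolding space3' by blast
    then obtain l where "l \<in> lines3 K" "p \<in> l" "l - {p} \<subseteq> N"
      using N unfolding nikodym_def by blast
    then show "\<exists>l\<in>lines3 K'. p' \<in> l \<and> l - {p'} \<subseteq> F ` N"
      using F_line p by (intro bexI[of _ "F ` l"]) auto
  qed
  then show ?thesis by (simp add: K'_def F_def)
qed

text \<open>The covering hypothesis concerns fields with carrier in \<open>nat\<close>. A finite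
  carrier injects into \<open>nat\<close>, so fields over any type come within its reach.\<close>

lemma nikodym_over_nat_ring:
  fixes K :: "'a ring"
  assumes K: "finite_field K" and N: "nikodym K N"
  obtains K' :: "nat ring" and N'
  where "finite_field K'" "order K' = order K" "nikodym K' N'" "card N' = card N"
proof -
  have fld: "field K" and fin: "finite (carrier K)" using K by (auto simp: finite_field_def)
  obtain f :: "'a \<Rightarrow> nat" where f: "inj_on f (carrier K)"
    using finite_imp_inj_to_nat_seg[OF fin] by blast
  have iso: "f \<in> ring_iso K (image_ring f K)" using f by (rule inj_imp_image_ring_iso)
  have "field (image_ring f K)"
    using field.ring_iso_imp_img_field[OF fld iso] by (simp add: image_ring_zero[symmetric])
  then have "finite_field (image_ring f K)"
    using fin by (simp add: finite_field_def image_ring_carrier)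
  moreover have "order (image_ring f K) = order K"
    by (simp add: order_def image_ring_carrier card_image[OF f])
  moreover have "nikodym (image_ring f K) (map_prod f (map_prod f f) ` N)"
    by (rule nikodym_image_ring[OF fld f N])
  moreover have "card (map_prod f (map_prod f f) ` N) = card N"
  proof (rule card_image)
    have "inj_on (map_prod f (map_prod f f)) (space3 K)"
      unfolding space3_def using f by (intro map_prod_inj_on)
    then show "inj_on (map_prod f (map_prod f f)) N"
      using N unfolding nikodym_def by (blast intro: inj_on_subset)
  qed
  ultimately show thesis by (rule that)
qed

section \<open>Asymptotic form\<close>

text \<open>A type variable is fixed inside an assumption, so there one type must represent all
  finite fields; \<open>nat\<close> does so up to isomorphism. The constants \<open>c\<close> and
  \<open>C\<close> make the orders of growth explicit, and the error function may depend on them but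
  on neither the line set nor more of the field than its order.\<close>

theorem theorem5:
  assumes covering: "\<And>c C :: real. c > 0 \<Longrightarrow> C > 0 \<Longrightarrow>
    \<exists>e :: nat \<Rightarrow> real. e \<in> o(\<lambda>_. 1) \<and>
      (\<forall>(K :: nat ring) L. finite_field K \<longrightarrow> L \<subseteq> lines3 K \<longrightarrow>
        real (card L) \<ge> c * real (order K) ^ 3 \<longrightarrow>
        (\<forall>\<pi>\<in>planes3 K. real (card {l \<in> L. l \<subseteq> \<pi>}) \<le> C * real (order K)) \<longrightarrow>
        real (card (points_on L)) \<ge> (1 - e (order K)) * real (order K) ^ 3)"
  shows "\<exists>e :: nat \<Rightarrow> real. e \<in> o(\<lambda>_. 1) \<and>
      (\<forall>(K :: 'a ring) N. finite_field K \<longrightarrow> nikodym K N \<longrightarrow>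
        real (card N) \<ge> (1 - e (order K)) * real (order K) ^ 3)"
proof -
  \<comment> \<open>The bound is first shown for each fixed \<open>\<epsilon>\<close> and all large
    \<open>q\<close>; one error function is assembled afterwards.\<close>
  have large: "\<forall>\<^sub>F q in sequentially. \<forall>(K :: 'a ring) N. finite_field K \<longrightarrow> nikodym K N \<longrightarrow>
      order K = q \<longrightarrow> (1 - \<epsilon>) * real q ^ 3 < card N" if eps: "\<epsilon> > 0" for \<epsilon> :: real
  proof -
    obtain e :: "nat \<Rightarrow> real" where e: "e \<in> o(\<lambda>_. 1)"
      and cov: "\<And>(K :: nat ring) L. finite_field K \<Longrightarrow> L \<subseteq> lines3 K \<Longrightarrow>
        \<epsilon> / 4 * real (order K) ^ 3 \<le> card L \<Longrightarrow>
        (\<And>\<pi>. \<pi> \<in> planes3 K \<Longrightarrow> card {l \<in> L. l \<subseteq> \<pi>} \<le> 16 / \<epsilon> * real (order K)) \<Longrightarrow>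
        (1 - e (order K)) * real (order K) ^ 3 \<le> card (points_on L)"
      using covering[of "\<epsilon> / 4" "16 / \<epsilon>"] eps by auto
    have "e \<longlonglongrightarrow> 0" using smalloD_tendsto[OF e] by simp
    \<comment> \<open>Half of \<open>\<epsilon>\<close> is the fraction of points that the
      constructed lines miss; an error below it gives the contradiction.\<close>
    then have "\<forall>\<^sub>F q in sequentially. e q < \<epsilon> / 2"
      using eps by (intro order_tendstoD(2)) auto
    moreover have "\<forall>\<^sub>F q in sequentially. 4 / \<epsilon> \<le> real q"
      by (rule filterlim_at_top[THEN iffD1, rule_format]) (rule filterlim_real_sequentially)
    moreover have "\<forall>\<^sub>F q in sequentially. 48 / \<epsilon> ^ 3 \<le> sqrt (real q)"
      by (rule filterlim_at_top[THEN iffD1, rule_format])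
         (rule filterlim_compose[OF sqrt_at_top filterlim_real_sequentially])
    moreover have "\<forall>\<^sub>F q in sequentially. q \<ge> (4::nat)" by (rule eventually_ge_at_top)
    ultimately show ?thesis
    proof eventually_elim
      fix q assume q: "e q < \<epsilon> / 2" "4 / \<epsilon> \<le> real q" "48 / \<epsilon> ^ 3 \<le> sqrt (real q)" "q \<ge> 4"
      show "\<forall>(K :: 'a ring) N. finite_field K \<longrightarrow> nikodym K N \<longrightarrow>
          order K = q \<longrightarrow> (1 - \<epsilon>) * real q ^ 3 < card N"
      proof (intro allI impI, rule ccontr)
        fix K0 :: "'a ring" and N0
        assume "finite_field K0" "nikodym K0 N0" and q0: "order K0 = q"
          and small: "\<not> (1 - \<epsilon>) * real q ^ 3 < card N0"
        then obtain K :: "nat ring" and N where K: "finite_field K" "order K = q"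
          and N: "nikodym K N" "card N = card N0"
          by (metis nikodym_over_nat_ring)
        interpret finite_field_space K
          using K(1) by (simp add: finite_field_def finite_field_space_def finite_field_space_axioms_def)
        from small have "card N \<le> (1 - \<epsilon>) * real (order K) ^ 3" by (simp add: N(2) K(2))
        from few_coplanar_lines_missing_many_points[OF N(1) eps this] q
        obtain L where L: "L \<subseteq> lines3 K" "\<epsilon> / 4 * real q ^ 3 \<le> card L"
          "\<And>\<pi>. \<pi> \<in> planes3 K \<Longrightarrow> card {l \<in> L. l \<subseteq> \<pi>} \<le> 16 / \<epsilon> * real q"
          "card (points_on L) \<le> (1 - \<epsilon> / 2) * real q ^ 3"
          unfolding K(2) by blast
        have "(1 - e q) * real q ^ 3 \<le> card (points_on L)"
          using cov[OF K(1) L(1)] L(2,3) K(2) by simp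
        then have "(1 - e q) * real q ^ 3 \<le> (1 - \<epsilon> / 2) * real q ^ 3"
          using L(4) by linarith
        then show False using q by simp
      qed
    qed
  qed
  \<comment> \<open>The error at \<open>q\<close> is the worst deficit of a Nikodym set over fields
    of order \<open>q\<close>. Deficits are at most 1, so the supremum is finite; the element 0
    keeps the set nonempty when there is no such field and makes the error nonnegative.\<close>
  define D where "D q = insert 0 {1 - card N / real q ^ 3 | (K :: 'a ring) N.
    finite_field K \<and> nikodym K N \<and> order K = q}" for q
  define e where "e q = Sup (D q)" for q
  have bdd: "bdd_above (D q)" for q
    by (rule bdd_aboveI[of _ 1]) (auto simp: D_def)
  have "e \<longlonglongrightarrow> 0"
  proof (rule tendstoI)
    fix \<epsilon> :: real assume eps: "\<epsilon> > 0"
    then have "\<forall>\<^sub>F q in sequentially. \<forall>(K :: 'a ring) N. finite_field K \<longrightarrow> nikodym K N \<longrightarrow>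
        order K = q \<longrightarrow> (1 - \<epsilon> / 2) * real q ^ 3 < card N"
      by (intro large) simp
    then show "\<forall>\<^sub>F q in sequentially. dist (e q) 0 < \<epsilon>"
      using eventually_gt_at_top[of 0]
    proof eventually_elim
      fix q :: nat
      assume N: "\<forall>(K :: 'a ring) N. finite_field K \<longrightarrow> nikodym K N \<longrightarrow>
        order K = q \<longrightarrow> (1 - \<epsilon> / 2) * real q ^ 3 < card N" and q: "q > 0"
      have "x \<le> \<epsilon> / 2" if "x \<in> D q" for x
      proof (cases "x = 0")
        case False
        with that obtain K :: "'a ring" and M where "x = 1 - card M / real q ^ 3"
          "finite_field K" "nikodym K M" "order K = q"
          unfolding D_def by blast
        then show ?thesis using N q by (fastforce simp: field_simps)
      qed (use eps in simp)
      then have "e q \<le> \<epsilon> / 2" unfolding e_def by (intro cSup_least) (auto simp: D_def)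
      moreover have "0 \<le> e q" unfolding e_def by (rule cSup_upper[OF _ bdd]) (simp add: D_def)
      ultimately show "dist (e q) 0 < \<epsilon>" using eps by simp
    qed
  qed
  then have "e \<in> o(\<lambda>_. 1)" by (intro smalloI_tendsto) auto
  moreover have "(1 - e (order K)) * real (order K) ^ 3 \<le> card N"
    if K: "finite_field K" and N: "nikodym K N" for K :: "'a ring" and N
  proof -
    have "order K > 0"
      using K by (auto simp: finite_field_def order_def card_gt_0_iff dest: field.is_ring ring.ring_simprules(2))
    moreover have "1 - card N / real (order K) ^ 3 \<le> e (order K)"
      unfolding e_def by (rule cSup_upper[OF _ bdd]) (use K N in \<open>auto simp: D_def\<close>)
    ultimately show ?thesis by (simp add: field_simps)
  qed
  ultimately show ?thesis by blast
qed

end
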